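(* Let $k$ be an algebraically closed field of characteristic $p>0$ and let $X\subset\mathbb P^n_k$ be a smooth extremal hypersurface. Then all smooth hyperplane sections of $X$ are isomorphic to each other.
   Context: A Frobenius form over a field $k$ of characteristic $p>0$ is a homogeneous polynomial of degree $q+1$ in a polynomial ring over $k$ that lies in the ideal generated by the $q$-th powers of the variables, where $q=p^e$ with $e>0$. An extremal hypersurface is a projective hypersurface defined by a (not necessarily reduced) Frobenius form. *)

theory Defs
  imports "HOL-Analysis.Analysis" "HOL-Library.Poly_Mapping"
    "HOL-Computational_Algebra.Polynomial"
begin

section \<open>Polynomials in several variables\<close>

text \<open>
  The polynomial ring \<open>k[x\<^sub>i | i \<in> 'n]\<close> is the monoid algebra of the monoid of exponent vectors;
  multiplication is the convolution product from \<^theory>\<open>HOL-Library.Poly_Mapping\<close>.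
  With \<open>CARD('n) = n + 1\<close> it is the homogeneous coordinate ring of \<open>n\<close>-dimensional
  projective space.
\<close>

type_synonym ('k, 'n) poly_ring = "('n \<Rightarrow>\<^sub>0 nat) \<Rightarrow>\<^sub>0 'k"

definition var :: "'n \<Rightarrow> ('k::comm_ring_1, 'n::finite) poly_ring" where
  "var i = Poly_Mapping.single (Poly_Mapping.single i 1) 1"

definition eval :: "('k::comm_ring_1, 'n::finite) poly_ring \<Rightarrow> 'k ^ 'n \<Rightarrow> 'k" where
  "eval f v = (\<Sum>m\<in>Poly_Mapping.keys f. Poly_Mapping.lookup f m * (\<Prod>i\<in>UNIV. (v $ i) ^ Poly_Mapping.lookup m i))"

text \<open>The zero polynomial is homogeneous of every degree.\<close>

definition homogeneous :: "nat \<Rightarrow> ('k::comm_ring_1, 'n::finite) poly_ring \<Rightarrow> bool" where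
  "homogeneous d f \<longleftrightarrow> (\<forall>m\<in>Poly_Mapping.keys f. (\<Sum>i\<in>UNIV. Poly_Mapping.lookup m i) = d)"

text \<open>If \<open>x\<^sub>i\<close> does not occur in a monomial, the truncated subtraction of exponents is harmless,
  since then the coefficient is \<open>0\<close>.\<close>

definition partial_deriv ::
    "'n \<Rightarrow> ('k::comm_ring_1, 'n::finite) poly_ring \<Rightarrow> ('k, 'n) poly_ring" where
  "partial_deriv i f = (\<Sum>m\<in>Poly_Mapping.keys f.
     Poly_Mapping.single (m - Poly_Mapping.single i 1) (of_nat (Poly_Mapping.lookup m i) * Poly_Mapping.lookup f m))"

definition gradient :: "('k::comm_ring_1, 'n::finite) poly_ring \<Rightarrow> 'k ^ 'n \<Rightarrow> 'k ^ 'n" where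
  "gradient f v = (\<chi> i. eval (partial_deriv i f) v)"

text \<open>The ideal generated by \<open>S\<close> is its span in the polynomial ring as a module over itself.\<close>

definition ideal_generated_by ::
    "('k::comm_ring_1, 'n::finite) poly_ring set \<Rightarrow> ('k, 'n) poly_ring set" where
  "ideal_generated_by S = module.span (*) S"

definition frobenius_form :: "('k::field, 'n::finite) poly_ring \<Rightarrow> bool" where
  "frobenius_form f \<longleftrightarrow>
     (\<exists>e>0. homogeneous (CHAR('k) ^ e + 1) f \<and>
            f \<in> ideal_generated_by (range (\<lambda>i. var i ^ (CHAR('k) ^ e))))"


section \<open>Projective space and projective varieties\<close>

text \<open>A point of projective space is the set of nonzero multiples of a nonzero vector.\<close>

type_synonym ('k, 'n) proj_point = "('k ^ 'n) set"

definition proj_class :: "'k::field ^ 'n::finite \<Rightarrow> ('k, 'n) proj_point" where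
  "proj_class v = {c *s v | c. c \<noteq> 0}"

definition proj_space :: "('k::field, 'n::finite) proj_point set" where
  "proj_space = {proj_class v | v. v \<noteq> 0}"

text \<open>Meaningful for sets \<open>S\<close> of homogeneous polynomials.\<close>

definition proj_zeros ::
    "('k::field, 'n::finite) poly_ring set \<Rightarrow> ('k, 'n) proj_point set" where
  "proj_zeros S = {proj_class v | v. v \<noteq> 0 \<and> (\<forall>f\<in>S. eval f v = 0)}"

definition zariski_open :: "('k::field, 'n::finite) proj_point set \<Rightarrow> bool" where
  "zariski_open U \<longleftrightarrow>
     (\<exists>S. (\<forall>f\<in>S. \<exists>d. homogeneous d f) \<and> U = proj_space - proj_zeros S)"

text \<open>
  A morphism between closed subsets of projective spaces: a map that, locally on the source in the
  Zariski topology, is given by homogeneous polynomials of one common degree without common zero.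
\<close>

definition proj_morphism ::
    "('k::field, 'n::finite) proj_point set \<Rightarrow> ('k, 'm::finite) proj_point set \<Rightarrow>
     (('k, 'n) proj_point \<Rightarrow> ('k, 'm) proj_point) \<Rightarrow> bool" where
  "proj_morphism Y Z \<phi> \<longleftrightarrow> \<phi> ` Y \<subseteq> Z \<and>
     (\<forall>P\<in>Y. \<exists>U. zariski_open U \<and> P \<in> U \<and>
        (\<exists>d F. (\<forall>j. homogeneous d (F j)) \<and>
           (\<forall>v. v \<noteq> 0 \<and> proj_class v \<in> Y \<inter> U \<longrightarrow>
              (\<chi> j. eval (F j) v) \<noteq> 0 \<and>
              \<phi> (proj_class v) = proj_class (\<chi> j. eval (F j) v))))"

definition proj_isomorphic ::
    "('k::field, 'n::finite) proj_point set \<Rightarrow> ('k, 'm::finite) proj_point set \<Rightarrow> bool" where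
  "proj_isomorphic Y Z \<longleftrightarrow>
     (\<exists>\<phi> \<psi>. proj_morphism Y Z \<phi> \<and> proj_morphism Z Y \<psi> \<and>
            (\<forall>P\<in>Y. \<psi> (\<phi> P) = P) \<and> (\<forall>Q\<in>Z. \<phi> (\<psi> Q) = Q))"

text \<open>
  Jacobian criterion: the subscheme of projective space cut out by the forms in \<open>S\<close> is smooth of
  codimension \<open>card S\<close> (or empty) iff the Jacobian matrix has rank \<open>card S\<close> at each of its points.
  The condition depends on the equations and not just on their zero set. Since a smooth scheme is
  reduced, over an algebraically closed field it is then determined by the variety
  \<open>proj_zeros S\<close>.
\<close>

definition smooth_complete_intersection ::
    "('k::field, 'n::finite) poly_ring set \<Rightarrow> bool" where
  "smooth_complete_intersection S \<longleftrightarrow> finite S \<and>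
     (\<forall>v. v \<noteq> 0 \<and> (\<forall>f\<in>S. eval f v = 0) \<longrightarrow>
        vec.dim ((\<lambda>f. gradient f v) ` S) = card S)"

definition hyperplane_form :: "('k::field, 'n::finite) poly_ring \<Rightarrow> bool" where
  "hyperplane_form l \<longleftrightarrow> l \<noteq> 0 \<and> homogeneous 1 l"

end

theory Submission
  imports Defs
begin

text \<open>
  A Frobenius form is \<open>f v = h v v\<close> for a form \<open>h\<close> that is linear in the first and \<open>q\<close>-Frobenius
  semilinear in the second argument, and the gradient of \<open>f\<close> at \<open>v\<close> represents the functional
  \<open>\<lambda>w. h w v\<close>. Hence a hyperplane section is smooth iff \<open>h\<close> is nondegenerate on the hyperplane. A
  nondegenerate \<open>h\<close> has an orthonormal basis: by the theorem of Lang for semilinear maps, the vectors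
  \<open>v\<close> with \<open>h v w = (h w v) ^ q\<close> for all \<open>w\<close> span the space, on these \<open>h\<close> is Hermitian over the
  field with \<open>q\<^sup>2\<close> elements, and the Gram-Schmidt process applies. So any two smooth hyperplane
  sections are carried into each other by a linear map of the ambient space.
\<close>

section \<open>Semilinear maps over an algebraically closed field\<close>

text \<open>If \<open>K\<close> is an orbit of a \<open>Q\<close>-semilinear map with \<open>K (m + 1) = (\<Sum>i\<le>m. b i *s K i)\<close>, these \<open>a\<close> are
  the coordinates of a fixed vector.\<close>

lemma twisted_recursion_solvable:
  fixes b :: "nat \<Rightarrow> 'k::alg_closed_field"
  assumes Q: "1 < Q" and j: "j \<le> m" "b j \<noteq> 0"
  obtains a where "a m \<noteq> 0" and "a 0 = a m ^ Q * b 0"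
    and "\<And>i. a (Suc i) = a i ^ Q + a m ^ Q * b (Suc i)"
proof -
  \<comment> \<open>\<open>P i\<close> is \<open>a i\<close> as a polynomial in the unknown
    \<open>y = a m\<close>. The recursion closes up as soon as \<open>poly (P m) y = y\<close>, and
    \<open>y\<close> must be nonzero.\<close>
  define P where "P = rec_nat (monom (b 0) Q) (\<lambda>i r. r ^ Q + monom (b (Suc i)) Q)"
  have P0: "P 0 = monom (b 0) Q" and PS: "P (Suc i) = P i ^ Q + monom (b (Suc i)) Q" for i
    by (simp_all add: P_def)
  have dvd: "monom 1 Q dvd P i" for i
  proof (induction i)
    case 0
    then show ?case
      using mult_monom[of 1 Q "b 0" 0] by (metis P0 add.right_neutral dvd_triv_left mult_1)
  next
    case (Suc i)
    have "monom 1 Q dvd P i ^ Q"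
      using Suc Q by (metis dvd_power dvd_trans less_trans zero_less_one)
    moreover have "monom 1 Q dvd monom (b (Suc i)) Q"
      using mult_monom[of 1 Q "b (Suc i)" 0] by (metis add.right_neutral dvd_triv_left mult_1)
    ultimately show ?case unfolding PS by (rule dvd_add)
  qed
  \<comment> \<open>A nonzero \<open>P i\<close> is divisible by \<open>monom 1 Q\<close>, so
    \<open>P i ^ Q\<close> has degree at least \<open>Q * Q > Q\<close> and cannot be cancelled by a
    monomial of degree at most \<open>Q\<close>.\<close>
  have zero: "P i = 0 \<Longrightarrow> k \<le> i \<Longrightarrow> b k = 0" for i k
  proof (induction i)
    case 0
    then show ?case by (simp add: P0)
  next
    case (Suc i)
    have "P i = 0"
    proof (rule ccontr)
      assume nz: "P i \<noteq> 0"
      have "Q * Q \<le> Q * degree (P i)"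
        using dvd_imp_degree_le[OF dvd nz] by (simp add: degree_monom_eq)
      moreover have "Q < Q * Q" using Q by simp
      ultimately have "Q < degree (P i ^ Q)"
        using nz by (simp add: degree_power_eq)
      moreover have "degree (monom (b (Suc i)) Q) \<le> Q" by (rule degree_monom_le)
      ultimately have "degree (P (Suc i)) > 0"
        unfolding PS by (subst degree_add_eq_left) auto
      with Suc.prems show False by simp
    qed
    moreover from this have "b (Suc i) = 0"
      using Suc.prems(1) Q unfolding PS by (simp add: power_0_left)
    ultimately show ?case using Suc by (metis le_Suc_eq)
  qed
  obtain r where r: "P m = monom 1 Q * r" using dvd[of m] by (rule dvdE)
  have "r \<noteq> 0" using zero[OF _ j(1)] j(2) r by auto
  \<comment> \<open>Dividing \<open>poly (P m) y = y\<close> by \<open>y\<close> leaves the equation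
    \<open>poly g y = 0\<close>; the constant term -1 of \<open>g\<close> keeps its roots away from
    0.\<close>
  define g where "g = monom 1 (Q - 1) * r - 1"
  have "degree (monom 1 (Q - 1) * r) = Q - 1 + degree r"
    using \<open>r \<noteq> 0\<close> by (subst degree_mult_eq) (auto simp: degree_monom_eq)
  then have "0 < degree g"
    unfolding g_def diff_conv_add_uminus using Q by (subst degree_add_eq_left) auto
  then obtain y where y: "poly g y = 0" using alg_closed_imp_poly_has_root by blast
  have "y \<noteq> 0" using y Q by (auto simp: g_def poly_monom power_0_left)
  have "poly (P m) y = y * (y ^ (Q - 1) * poly r y)"
    using Q by (simp add: r poly_monom power_eq_if)
  also have "\<dots> = y" using y by (simp add: g_def poly_monom)
  finally have Pm: "poly (P m) y = y" .
  show thesis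
    by (rule that[of "\<lambda>i. poly (P i) y"]) (simp_all add: Pm \<open>y \<noteq> 0\<close> P0 PS poly_monom mult.commute)
qed

lemma span_Un_sequence:
  fixes K :: "nat \<Rightarrow> 'k::field ^ 'n::finite"
  assumes "x \<in> vec.span (F \<union> K ` {..<m})"
  shows "\<exists>s\<in>vec.span F. \<exists>b. x = s + (\<Sum>i<m. b i *s K i)"
  using assms
proof (induction m arbitrary: x)
  case 0
  then show ?case by auto
next
  case (Suc m)
  have "x \<in> vec.span (insert (K m) (F \<union> K ` {..<m}))"
    using Suc.prems by (simp add: lessThan_Suc)
  then obtain c where "x - c *s K m \<in> vec.span (F \<union> K ` {..<m})"
    by (auto simp: vec.span_breakdown_eq)
  then obtain s b where s: "s \<in> vec.span F" and "x - c *s K m = s + (\<Sum>i<m. b i *s K i)"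
    using Suc.IH by blast
  then have "x = s + (\<Sum>i<Suc m. (b(m := c)) i *s K i)"
    by (simp add: algebra_simps)
  with s show ?case by blast
qed

text \<open>Otherwise every \<open>K m\<close> would raise the dimension of the span by one, beyond
  that of the space.\<close>

lemma sequence_eventually_dependent:
  fixes K :: "nat \<Rightarrow> 'k::field ^ 'n::finite"
  shows "\<exists>m. K m \<in> vec.span (F \<union> K ` {..<m})"
proof (rule ccontr)
  assume *: "\<nexists>m. K m \<in> vec.span (F \<union> K ` {..<m})"
  have "m \<le> vec.dim (F \<union> K ` {..<m})" for m
    by (induction m) (use * in \<open>simp_all add: lessThan_Suc vec.dim_insert\<close>)
  then show False
    using vec.dim_subset_UNIV Suc_n_not_le_n order_trans by blast
qed

section \<open>Lang's theorem for semilinear maps\<close>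

locale frobenius_semilinear =
  fixes Q :: nat and T :: "'k::alg_closed_field ^ 'n::finite \<Rightarrow> 'k ^ 'n"
  assumes Q: "1 < Q"
    and add: "T (x + y) = T x + T y"
    and scale: "T (c *s x) = c ^ Q *s T x"
    and eq_0: "T x = 0 \<Longrightarrow> x = 0"
begin

abbreviation fixed_points where "fixed_points \<equiv> {x. T x = x}"

lemma zero [simp]: "T 0 = 0"
  using add[of 0 0] by simp

lemma diff: "T (x - y) = T x - T y"
  using add[of "x - y" y] by simp

lemma sum: "T (\<Sum>i\<in>I. g i) = (\<Sum>i\<in>I. T (g i))"
  by (induction I rule: infinite_finite_induct) (simp_all add: add)

lemma span_fixed_points_preimage:
  assumes "t \<in> vec.span fixed_points"
  shows "\<exists>s\<in>vec.span fixed_points. T s = t"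
  using assms
proof (induction rule: vec.span_induct_alt)
  case base
  then show ?case using zero vec.span_zero by blast
next
  case (step c x y)
  then obtain s where s: "s \<in> vec.span fixed_points" "T s = y" by blast
  \<comment> \<open>\<open>T\<close> raises the coefficient of a fixed point to the power
    \<open>Q\<close>, so a \<open>Q\<close>-th root lifts it.\<close>
  obtain d where "d ^ Q = c" using nth_root_exists[of Q c] Q by auto
  then have "T (d *s x + s) = c *s x + y" using step s by (simp add: add scale)
  moreover have "d *s x + s \<in> vec.span fixed_points"
    using step(1) s(1) by (simp add: vec.span_add vec.span_scale vec.span_base)
  ultimately show ?case by blast
qed

text \<open>For each coefficient this is the Artin-Schreier type equation
  \<open>d ^ Q - d = c\<close>, solvable over an algebraically closed field.\<close>

lemma span_fixed_points_difference:
  assumes "t \<in> vec.span fixed_points"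
  shows "\<exists>s\<in>vec.span fixed_points. T s - s = t"
  using assms
proof (induction rule: vec.span_induct_alt)
  case base
  then show ?case using zero vec.span_zero by (metis diff_zero)
next
  case (step c x y)
  then obtain s where s: "s \<in> vec.span fixed_points" "T s - s = y" by blast
  have "degree (monom 1 Q + [:- c, - 1:]) = Q"
    using Q by (subst degree_add_eq_left) (auto simp: degree_monom_eq)
  then obtain d where "poly (monom 1 Q + [:- c, - 1:]) d = 0"
    using alg_closed_imp_poly_has_root[of "monom 1 Q + [:- c, - 1:]"] Q by auto
  then have d: "d ^ Q = c + d" by (simp add: poly_monom algebra_simps)
  then have "T (d *s x + s) - (d *s x + s) = c *s x + y"
    using step(1) unfolding s(2)[symmetric] by (simp add: add scale vec.scale_left_distrib)
  moreover have "d *s x + s \<in> vec.span fixed_points"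
    using step(1) s(1) by (simp add: vec.span_add vec.span_scale vec.span_base)
  ultimately show ?case by blast
qed

text \<open>Each vector of the span already has a preimage inside the span, and \<open>T\<close> is
  injective.\<close>

lemma span_fixed_points_reflect:
  assumes "T x \<in> vec.span fixed_points"
  shows "x \<in> vec.span fixed_points"
proof -
  obtain s where "s \<in> vec.span fixed_points" "T s = T x"
    using span_fixed_points_preimage[OF assms] by blast
  moreover from this have "T (s - x) = 0" by (simp add: diff)
  then have "s - x = 0" by (rule eq_0)
  ultimately show ?thesis by simp
qed

lemma span_fixed_points_reflect_iterate:
  "(T ^^ i) x \<in> vec.span fixed_points \<Longrightarrow> x \<in> vec.span fixed_points"
  by (induction i) (auto dest: span_fixed_points_reflect)

text \<open>Let \<open>w\<close> lie outside the span. At the first linear dependence in its orbit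
  modulo the span, a combination of the orbit is built that \<open>T\<close> fixes up to an element
  of the span. Correcting it to a fixed point yields an earlier dependence.\<close>

theorem span_fixed_points: "vec.span fixed_points = UNIV"
proof (rule ccontr)
  let ?S = "vec.span fixed_points"
  assume "?S \<noteq> UNIV"
  then obtain w where w: "w \<notin> ?S" by blast
  define K where "K i = (T ^^ i) w" for i
  have TK: "T (K i) = K (Suc i)" for i by (simp add: K_def)
  define dep where "dep m \<longleftrightarrow> K m \<in> vec.span (fixed_points \<union> K ` {..<m})" for m
  define m where "m = (LEAST m. dep m)"
  have "dep m"
    unfolding m_def by (rule LeastI_ex) (simp add: dep_def sequence_eventually_dependent)
  moreover have "\<not> dep 0" using w by (simp add: dep_def K_def)
  ultimately obtain n where n: "m = Suc n" by (metis not0_implies_Suc)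
  have min: "\<not> dep n" using not_less_Least[of n dep] n by (simp add: m_def)
  obtain s b where s: "s \<in> ?S" and Km: "K (Suc n) = s + (\<Sum>i<Suc n. b i *s K i)"
    using span_Un_sequence \<open>dep m\<close> unfolding dep_def n by blast
  \<comment> \<open>If all \<open>b j\<close> vanished, an iterate of \<open>w\<close>, and hence
    \<open>w\<close> itself, would lie in the span.\<close>
  have "\<exists>j\<le>n. b j \<noteq> 0"
  proof (rule ccontr)
    assume "\<not> (\<exists>j\<le>n. b j \<noteq> 0)"
    then have "(\<Sum>i<Suc n. b i *s K i) = 0" by (intro sum.neutral) auto
    then have "K (Suc n) \<in> ?S" using s Km by simp
    then show False using w span_fixed_points_reflect_iterate unfolding K_def by blast
  qed
  then obtain j where "j \<le> n" "b j \<noteq> 0" by blast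
  from twisted_recursion_solvable[of Q j n b, OF Q this] obtain a
    where a: "a n \<noteq> 0" "a 0 = a n ^ Q * b 0"
      "\<And>i. a (Suc i) = a i ^ Q + a n ^ Q * b (Suc i)" by metis
  define u where "u = (\<Sum>i<Suc n. a i *s K i)"
  \<comment> \<open>Substituting the dependence for \<open>K (Suc n)\<close> and using the recursion
    for \<open>a\<close> returns \<open>u\<close> modulo the span.\<close>
  have "T u = (\<Sum>i<Suc n. a i ^ Q *s K (Suc i))"
    by (simp add: u_def sum scale TK add)
  also have "\<dots> = (\<Sum>i<n. a i ^ Q *s K (Suc i)) + a n ^ Q *s s
      + (\<Sum>i<Suc n. (a n ^ Q * b i) *s K i)"
    by (simp add: Km vec.scale_right_distrib vec.scale_sum_right add.assoc)
  also have "\<dots> = a n ^ Q *s s + u"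
    unfolding u_def sum.lessThan_Suc_shift[of _ n]
    by (simp add: a(2,3) vec.scale_left_distrib sum.distrib)
  finally have "T u - u \<in> ?S" using s by (simp add: vec.span_scale)
  then obtain t where t: "t \<in> ?S" "T t - t = T u - u"
    using span_fixed_points_difference by blast
  then have "T (u - t) = u - t" by (simp add: diff algebra_simps)
  then have "u - t \<in> ?S" by (intro vec.span_base) simp
  then have "u \<in> ?S" using t(1) vec.span_add by fastforce
  \<comment> \<open>Since \<open>a n\<close> is nonzero, \<open>u \<in> ?S\<close> can be solved for
    \<open>K n\<close>.\<close>
  have "dep n"
  proof -
    let ?W = "vec.span (fixed_points \<union> K ` {..<n})"
    have "u \<in> ?W" using \<open>u \<in> ?S\<close> vec.span_mono[of fixed_points] by blast
    moreover have "(\<Sum>i<n. a i *s K i) \<in> ?W"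
      by (intro vec.span_sum vec.span_scale vec.span_base) auto
    ultimately have "u - (\<Sum>i<n. a i *s K i) \<in> ?W" by (rule vec.span_diff)
    then have "a n *s K n \<in> ?W" by (simp add: u_def)
    then have "inverse (a n) *s (a n *s K n) \<in> ?W" by (rule vec.span_scale)
    then show ?thesis using a(1) by (simp add: dep_def)
  qed
  with min show False ..
qed

end

section \<open>Sesquilinear forms for the Frobenius\<close>

text \<open>\<open>frobenius_add\<close> stands for the fact that \<open>q\<close> is a power of the
  characteristic.\<close>

locale frobenius_sesquilinear =
  fixes q :: nat and h :: "'k::alg_closed_field ^ 'n::finite \<Rightarrow> 'k ^ 'n \<Rightarrow> 'k"
  assumes q: "1 < q"
    and frobenius_add: "((a::'k) + b) ^ q = a ^ q + b ^ q"
    and add_left: "h (x + y) z = h x z + h y z"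
    and scale_left: "h (c *s x) z = c * h x z"
    and add_right: "h z (x + y) = h z x + h z y"
    and scale_right: "h z (c *s x) = c ^ q * h z x"
begin

lemma frobenius_zero: "(0::'k) ^ q = 0"
  using q by (simp add: power_0_left)

lemma frobenius_minus: "(- a :: 'k) ^ q = - (a ^ q)"
  using frobenius_add[of a "- a"] by (simp add: frobenius_zero add_eq_0_iff)

lemma frobenius_diff: "(a - b :: 'k) ^ q = a ^ q - b ^ q"
  using frobenius_add[of a "- b"] by (simp add: frobenius_minus)

lemma frobenius_sum: "(\<Sum>i\<in>I. f i :: 'k) ^ q = (\<Sum>i\<in>I. f i ^ q)"
  by (induction I rule: infinite_finite_induct) (simp_all add: frobenius_zero frobenius_add)

lemma zero_left [simp]: "h 0 z = 0"
  using scale_left[of 0 0 z] by simp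

lemma zero_right [simp]: "h z 0 = 0"
  using scale_right[of z 0 0] by (simp add: frobenius_zero)

lemma diff_left: "h (x - y) z = h x z - h y z"
  using add_left[of "x - y" y z] by simp

lemma diff_right: "h z (x - y) = h z x - h z y"
  using add_right[of z "x - y" y] by simp

lemma sum_left: "h (\<Sum>i\<in>I. f i) z = (\<Sum>i\<in>I. h (f i) z)"
  by (induction I rule: infinite_finite_induct) (simp_all add: add_left)

lemma sum_right: "h z (\<Sum>i\<in>I. f i) = (\<Sum>i\<in>I. h z (f i))"
  by (induction I rule: infinite_finite_induct) (simp_all add: add_right)

lemma expand_left: "h x z = (\<Sum>i\<in>UNIV. x $ i * h (axis i 1) z)"
proof -
  have "h x z = h (\<Sum>i\<in>UNIV. x $ i *s axis i 1) z" by (simp only: basis_expansion)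
  then show ?thesis by (simp add: sum_left scale_left)
qed

lemma expand_right: "h z x = (\<Sum>i\<in>UNIV. (x $ i) ^ q * h z (axis i 1))"
proof -
  have "h z x = h z (\<Sum>i\<in>UNIV. x $ i *s axis i 1)" by (simp only: basis_expansion)
  then show ?thesis by (simp add: sum_right scale_right)
qed

lemma zero_on_span:
  assumes "x \<in> vec.span S" and "\<And>y. y \<in> S \<Longrightarrow> h y z = 0"
  shows "h x z = 0"
  using assms(1)
  by (induction rule: vec.span_induct_alt) (simp_all add: add_left scale_left assms(2))

definition orthonormal where
  "orthonormal E \<longleftrightarrow> (\<forall>x\<in>E. \<forall>y\<in>E. h x y = (if x = y then 1 else 0))"

text \<open>Pairing a vanishing combination with \<open>v\<close> on the right isolates the
  coefficient of \<open>v\<close>.\<close>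

lemma orthonormal_independent:
  assumes "orthonormal E"
  shows "vec.independent E"
  unfolding vec.dependent_explicit
proof safe
  fix S u v
  assume S: "finite S" "S \<subseteq> E" "(\<Sum>v\<in>S. u v *s v) = 0" and v: "v \<in> S" and "u v \<noteq> 0"
  have "0 = (\<Sum>w\<in>S. u w * h w v)"
    using arg_cong[OF S(3), of "\<lambda>x. h x v"] by (simp add: sum_left scale_left)
  also have "\<dots> = (\<Sum>w\<in>S. if w = v then u w else 0)"
    using assms S(2) v unfolding orthonormal_def by (intro sum.cong refl) (simp add: subset_iff)
  also have "\<dots> = u v" using S(1) v by simp
  finally show False using \<open>u v \<noteq> 0\<close> by simp
qed

text \<open>In the field with \<open>q * q\<close> elements, conjugation is the \<open>q\<close>-th
  power. Membership of a scalar is expressed by \<open>c ^ (q * q) = c\<close>, and the hermitian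
  vectors form a vector space over that field.\<close>

definition hermitian where
  "hermitian v \<longleftrightarrow> (\<forall>w. h v w = h w v ^ q)"

lemma hermitian_add: "hermitian v \<Longrightarrow> hermitian w \<Longrightarrow> hermitian (v + w)"
  by (simp add: hermitian_def add_left add_right frobenius_add)

lemma hermitian_scale: "hermitian v \<Longrightarrow> c ^ (q * q) = c \<Longrightarrow> hermitian (c *s v)"
  by (simp add: hermitian_def scale_left scale_right power_mult_distrib power_mult)

lemma hermitian_zero: "hermitian 0"
  by (simp add: hermitian_def frobenius_zero)

lemma hermitian_diff: "hermitian v \<Longrightarrow> hermitian w \<Longrightarrow> hermitian (v - w)"
  by (simp add: hermitian_def diff_left diff_right frobenius_diff)

lemma hermitian_sum: "(\<And>i. i \<in> I \<Longrightarrow> hermitian (f i)) \<Longrightarrow> hermitian (\<Sum>i\<in>I. f i)"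
  by (induction I rule: infinite_finite_induct) (simp_all add: hermitian_zero hermitian_add)

text \<open>Exchanging the arguments twice applies the \<open>q\<close>-th power twice.\<close>

lemma hermitian_values: "hermitian v \<Longrightarrow> hermitian w \<Longrightarrow> h v w ^ (q * q) = h v w"
  unfolding hermitian_def by (metis power_mult)

lemma hermitian_eq_0_commute: "hermitian v \<Longrightarrow> h v w = 0 \<longleftrightarrow> h w v = 0"
  using q by (simp add: hermitian_def)

text \<open>This is surjectivity of the norm \<open>c ^ (q + 1)\<close> onto the field with
  \<open>q\<close> elements, which contains \<open>h v v\<close>: the norm of \<open>c\<close> is
  fixed by the \<open>q\<close>-th power, so cancelling \<open>c ^ q\<close> gives
  \<open>c ^ (q * q) = c\<close>.\<close>

lemma normalize:
  assumes "hermitian v" and "h v v \<noteq> 0"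
  shows "\<exists>c. c ^ (q * q) = c \<and> h (c *s v) (c *s v) = 1"
proof -
  have "\<exists>c. c ^ (q + 1) = inverse (h v v)" by (rule nth_root_exists) simp
  then obtain c where c: "c ^ (q + 1) = inverse (h v v)" ..
  have "h v v ^ q = h v v" using assms(1) unfolding hermitian_def by (rule allE) (rule sym)
  then have "(c ^ (q + 1)) ^ q = c ^ (q + 1)" by (simp only: c power_inverse)
  moreover have "(c ^ (q + 1)) ^ q = c ^ (q * q) * c ^ q"
    by (simp only: distrib_right mult_1 flip: power_mult power_add)
  moreover have "c ^ (q + 1) = c * c ^ q" by simp
  ultimately have "c ^ (q * q) * c ^ q = c * c ^ q" by (simp only:)
  moreover have "c \<noteq> 0" using c assms(2) by auto
  ultimately have "c ^ (q * q) = c" by simp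
  moreover have "h (c *s v) (c *s v) = c ^ (q + 1) * h v v"
    by (simp add: scale_left scale_right)
  then have "h (c *s v) (c *s v) = 1" using c assms(2) by simp
  ultimately show ?thesis by blast
qed

text \<open>In the isotropic case this uses an element of trace 1 over \<open>\<bbbF>\<^sub>q\<close>.\<close>

lemma hermitian_pair_unit_vector:
  assumes v: "hermitian v" and w: "hermitian w" and nz: "h w v \<noteq> 0"
  shows "\<exists>c d. c ^ (q * q) = c \<and> d ^ (q * q) = d \<and> h (c *s v + d *s w) (c *s v + d *s w) = 1"
proof -
  have zero: "(0::'k) ^ (q * q) = 0" using q by (simp add: power_0_left)
  consider "h v v \<noteq> 0" | "h w w \<noteq> 0" | "h v v = 0" "h w w = 0" by blast
  then show ?thesis
  proof cases
    case 1
    then obtain c where "c ^ (q * q) = c" "h (c *s v) (c *s v) = 1" using normalize v by blast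
    with zero show ?thesis by - (rule exI[of _ c], rule exI[of _ 0], simp)
  next
    case 2
    then obtain d where "d ^ (q * q) = d" "h (d *s w) (d *s w) = 1" using normalize w by blast
    with zero show ?thesis by - (rule exI[of _ 0], rule exI[of _ d], simp)
  next
    case 3
    have "degree (monom 1 q + [:- 1, 1 :: 'k:]) = q"
      using q by (subst degree_add_eq_left) (auto simp: degree_monom_eq)
    then obtain t where "poly (monom 1 q + [:- 1, 1 :: 'k:]) t = 0"
      using alg_closed_imp_poly_has_root[of "monom 1 q + [:- 1, 1 :: 'k:]"] q by auto
    then have t: "t ^ q = 1 - t" by (simp add: poly_monom algebra_simps)
    \<comment> \<open>With this scaling the two mixed terms become \<open>t ^ q\<close> and
      \<open>t\<close>, whose sum is 1.\<close>
    define d where "d = t / h w v"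
    have "t ^ (q * q) = t" by (simp add: power_mult t frobenius_diff)
    then have d: "d ^ (q * q) = d"
      by (simp add: d_def power_divide hermitian_values[OF w v])
    have "h v w = h w v ^ q" using v by (simp add: hermitian_def)
    then have "h (1 *s v + d *s w) (1 *s v + d *s w) = (d * h w v) ^ q + d * h w v"
      by (simp add: add_left add_right scale_left scale_right 3 power_mult_distrib)
    also have "d * h w v = t" using nz by (simp add: d_def)
    finally have "h (1 *s v + d *s w) (1 *s v + d *s w) = 1" by (simp only: t diff_add_cancel)
    with d show ?thesis by (intro exI conjI) (rule power_one, assumption+)
  qed
qed

end

section \<open>Orthonormal bases for nondegenerate forms\<close>

locale nondegenerate_sesquilinear = frobenius_sesquilinear +
  assumes nondegenerate: "(\<And>x. h x y = 0) \<Longrightarrow> y = 0"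
begin

lemma
  shows represent: "\<exists>u. \<forall>j. h u (axis j 1) = t j"
    and nondegenerate_left: "(\<And>y. h x y = 0) \<Longrightarrow> x = 0"
proof -
  define B :: "'a ^ 'b ^ 'b" where "B = (\<chi> i j. h (axis i 1) (axis j 1))"
  have "y = 0" if y: "B *v y = 0" for y
  proof -
    \<comment> \<open>Taking \<open>q\<close>-th roots of the coordinates turns the product with the
      Gram matrix \<open>B\<close> into values of \<open>h\<close>, which is semilinear on the
      right.\<close>
    have "\<exists>z. z ^ q = y $ j" for j using nth_root_exists[of q] q by auto
    then obtain z where z: "\<And>j. z j ^ q = y $ j" by metis
    have "h (axis i 1) (\<chi> j. z j) = 0" for i
      using arg_cong[OF y, of "\<lambda>v. v $ i"]
      by (subst expand_right) (simp add: z B_def matrix_vector_mult_def mult.commute)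
    then have "h x (\<chi> j. z j) = 0" for x by (subst expand_left) simp
    then have "(\<chi> j. z j) = 0" by (rule nondegenerate)
    then have "z j = 0" for j by (simp add: vec_eq_iff)
    then show "y = 0" using frobenius_zero by (simp add: vec_eq_iff flip: z)
  qed
  then have "\<exists>B'. B' ** B = mat 1" by (simp add: matrix_left_invertible_ker)
  then obtain C where C: "transpose B ** C = mat 1" by (auto simp flip: right_invertible_transpose)
  \<comment> \<open>On the linear left side no roots are needed, so both claims follow from
    invertibility of the transpose.\<close>
  have B: "(transpose B *v u) $ j = h u (axis j 1)" for u j
    by (subst expand_left) (simp add: B_def matrix_vector_mult_def transpose_def mult.commute)
  show "\<exists>u. \<forall>j. h u (axis j 1) = t j"
  proof (intro exI allI)
    fix j
    have "transpose B *v (C *v (\<chi> j. t j)) = (\<chi> j. t j)"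
      by (simp add: matrix_vector_mul_assoc C)
    then show "h (C *v (\<chi> j. t j)) (axis j 1) = t j" unfolding B[symmetric] by simp
  qed
  show "x = 0" if "\<And>y. h x y = 0"
  proof -
    have "transpose B *v x = 0" using that by (simp add: vec_eq_iff B del: transpose_matrix_vector)
    moreover have "C ** transpose B = mat 1" using C by (simp add: matrix_left_right_inverse)
    ultimately show ?thesis
      using matrix_vector_mul_assoc[of C "transpose B" x]
      by (simp del: transpose_matrix_vector)
  qed
qed

text \<open>Both sides are \<open>q\<close>-semilinear in \<open>w\<close>, so it suffices to match
  them on the standard basis.\<close>

lemma adjoint_exists: "\<exists>u. \<forall>w. h u w = h w v ^ q"
proof -
  obtain u where u: "h u (axis j 1) = h (axis j 1) v ^ q" for j
    using represent[where t = "\<lambda>j. h (axis j 1) v ^ q"] by blast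
  have "h u w = (\<Sum>j\<in>UNIV. w $ j * h (axis j 1) v) ^ q" for w
    by (subst expand_right) (simp add: u frobenius_sum power_mult_distrib)
  then show ?thesis unfolding expand_left[symmetric] by blast
qed

text \<open>The map \<open>T\<close> with \<open>h (T v) w = (h w v) ^ q\<close> is semilinear for the \<open>q\<^sup>2\<close>-Frobenius, and its fixed
  points are the hermitian vectors.\<close>

lemma span_hermitian: "vec.span {v. hermitian v} = UNIV"
proof -
  obtain T where T: "h (T v) w = h w v ^ q" for v w using adjoint_exists by metis
  have eqI: "x = y" if "\<And>w. h x w = h y w" for x y
    using nondegenerate_left[of "x - y"] that by (simp add: diff_left)
  interpret T: frobenius_semilinear "q * q" T
  proof
    show "1 < q * q" using q q by (rule less_1_mult)
    show "T (x + y) = T x + T y" for x y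
      by (rule eqI) (simp add: T add_left add_right frobenius_add)
    show "T (c *s x) = c ^ (q * q) *s T x" for c x
      by (rule eqI) (simp add: T scale_left scale_right power_mult_distrib power_mult)
    show "x = 0" if "T x = 0" for x
    proof (rule nondegenerate)
      fix w
      have "h w x ^ q = 0" using T[of x w] that by simp
      then show "h w x = 0" by simp
    qed
  qed
  have "hermitian v \<longleftrightarrow> T v = v" for v
    unfolding hermitian_def T[of v, symmetric] using eqI[of v "T v"] by auto
  then show ?thesis using T.span_fixed_points by simp
qed

text \<open>An orthonormal set of hermitian vectors of maximal size must span: otherwise the
  orthogonal complement contains a hermitian unit vector that enlarges it.\<close>

theorem extend_to_orthonormal_basis:
  assumes "orthonormal E" and "\<And>e. e \<in> E \<Longrightarrow> hermitian e"
  shows "\<exists>B. E \<subseteq> B \<and> orthonormal B \<and> vec.span B = UNIV"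
proof -
  define good where "good B \<longleftrightarrow> E \<subseteq> B \<and> orthonormal B \<and> (\<forall>b\<in>B. hermitian b)" for B
  have bound: "finite B \<and> card B \<le> CARD('b)" if "good B" for B
    using vec.independent_bound_general[OF orthonormal_independent, of B]
      dim_subset_UNIV_cart_gen[of B] that
    unfolding good_def by linarith
  have "good E" using assms by (simp add: good_def)
  then obtain B where B: "good B" and max: "\<And>C. good C \<Longrightarrow> card C \<le> card B"
    using ex_has_greatest_nat[of good E card "Suc CARD('b)"] bound by (auto simp: less_Suc_eq_le)
  have fin: "finite B" and ortho: "orthonormal B" and herm: "\<And>b. b \<in> B \<Longrightarrow> hermitian b"
    using B bound by (auto simp: good_def)
  have "vec.span B = UNIV"
  proof (rule ccontr)
    assume "vec.span B \<noteq> UNIV"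
    then have "\<not> {v. hermitian v} \<subseteq> vec.span B"
      using span_hermitian vec.span_minimal[OF _ vec.subspace_span] by blast
    then obtain v where v: "hermitian v" "v \<notin> vec.span B" by blast
    \<comment> \<open>\<open>p\<close> projects to the complement of \<open>B\<close>. The
      coefficients \<open>h x b\<close> of a hermitian \<open>x\<close> lie in the field with
      \<open>q * q\<close> elements, so \<open>p x\<close> stays hermitian.\<close>
    define p where "p x = x - (\<Sum>b\<in>B. h x b *s b)" for x
    have p_herm: "hermitian (p x)" if "hermitian x" for x
      unfolding p_def using that herm
      by (intro hermitian_diff hermitian_sum hermitian_scale hermitian_values)
    have p_orth: "h (p x) b = 0" if "b \<in> B" for x b
    proof -
      have "(\<Sum>e\<in>B. h x e * h e b) = (\<Sum>e\<in>B. if e = b then h x e else 0)"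
        using ortho that unfolding orthonormal_def by (intro sum.cong) auto
      also have "\<dots> = h x b" using fin that by simp
      finally show ?thesis by (simp add: p_def diff_left sum_left scale_left)
    qed
    have "p v \<noteq> 0"
    proof
      assume "p v = 0"
      then have "v = (\<Sum>b\<in>B. h v b *s b)" by (simp add: p_def)
      also have "\<dots> \<in> vec.span B" by (intro vec.span_sum vec.span_scale vec.span_base)
      finally show False using v by simp
    qed
    then obtain x where "h x (p v) \<noteq> 0" using nondegenerate by blast
    \<comment> \<open>If all hermitian vectors paired to 0 with \<open>p v\<close>, so would their
      span, which is everything.\<close>
    then obtain w where w: "hermitian w" "h w (p v) \<noteq> 0"
      using zero_on_span[of x "{v. hermitian v}" "p v"] span_hermitian by auto
    have "h b (p v) = 0" if "b \<in> B" for b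
      using p_orth that hermitian_eq_0_commute herm by blast
    \<comment> \<open>Projecting \<open>w\<close> leaves the pairing unchanged, because
      \<open>B\<close> is orthogonal to \<open>p v\<close>.\<close>
    then have "h (p w) (p v) \<noteq> 0"
      using w(2) by (simp add: p_def[of w] diff_left sum_left scale_left)
    then obtain c d where cd: "c ^ (q * q) = c" "d ^ (q * q) = d"
      and unit: "h (c *s p v + d *s p w) (c *s p v + d *s p w) = 1"
      using hermitian_pair_unit_vector p_herm v(1) w(1) by blast
    define u where "u = c *s p v + d *s p w"
    have u: "hermitian u"
      unfolding u_def using cd p_herm v(1) w(1) by (intro hermitian_add hermitian_scale)
    have u_orth: "h u b = 0" "h b u = 0" if "b \<in> B" for b
    proof -
      show "h u b = 0" using p_orth that by (simp add: u_def add_left scale_left)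
      then show "h b u = 0" using hermitian_eq_0_commute u by blast
    qed
    have "u \<notin> B" using u_orth unit by (auto simp: u_def)
    moreover have "good (insert u B)"
      using B u u_orth unit by (auto simp: good_def orthonormal_def u_def)
    then have "card (insert u B) \<le> card B" by (rule max)
    ultimately show False using fin by simp
  qed
  with B show ?thesis unfolding good_def by (intro exI[of _ B]) simp
qed

end

text \<open>Orthonormal bases through \<open>e\<close> and \<open>e'\<close> have equal size; a
  bijection sending \<open>e\<close> to \<open>e'\<close> extends linearly to an isometry.\<close>

theorem nondegenerate_isometry:
  fixes h h' :: "'k::alg_closed_field ^ 'n::finite \<Rightarrow> 'k ^ 'n \<Rightarrow> 'k"
  assumes "nondegenerate_sesquilinear q h" and "nondegenerate_sesquilinear q h'"
    and e: "frobenius_sesquilinear.hermitian q h e" "h e e = 1"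
    and e': "frobenius_sesquilinear.hermitian q h' e'" "h' e' e' = 1"
  obtains L where "Vector_Spaces.linear (*s) (*s) L" and "inj L" and "L e = e'"
    and "\<And>x y. h' (L x) (L y) = h x y"
proof -
  interpret h: nondegenerate_sesquilinear q h by fact
  interpret h': nondegenerate_sesquilinear q h' by fact
  have ortho: "h.orthonormal {e}" "h'.orthonormal {e'}"
    using e(2) e'(2) by (simp_all add: h.orthonormal_def h'.orthonormal_def)
  obtain B where B: "{e} \<subseteq> B" "h.orthonormal B" "vec.span B = UNIV"
    using h.extend_to_orthonormal_basis[of "{e}"] e(1)
    by (metis (no_types) ortho(1) singletonD)
  obtain B' where B': "{e'} \<subseteq> B'" "h'.orthonormal B'" "vec.span B' = UNIV"
    using h'.extend_to_orthonormal_basis[of "{e'}"] e'(1)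
    by (metis (no_types) ortho(2) singletonD)
  have ind: "vec.independent B" "vec.independent B'"
    using h.orthonormal_independent h'.orthonormal_independent B B' by blast+
  then have fin: "finite B" "finite B'" using vec.finiteI_independent by blast+
  have "card B = card B'"
    using B(3) B'(3) ind by (metis vec.dim_eq_card_independent vec.dim_span)
  then have "card (B - {e}) = card (B' - {e'})" using B(1) B'(1) fin by simp
  then obtain g where g: "bij_betw g (B - {e}) (B' - {e'})"
    using fin finite_same_card_bij[of "B - {e}" "B' - {e'}"] by blast
  define g' where "g' = g(e := e')"
  have "bij_betw g' (B - {e}) (B' - {e'})"
    using g by (rule bij_betw_cong[THEN iffD1, rotated]) (simp add: g'_def)
  moreover have "bij_betw g' {e} {e'}" by (simp add: g'_def)
  ultimately have "bij_betw g' ((B - {e}) \<union> {e}) ((B' - {e'}) \<union> {e'})"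
    by (rule bij_betw_combine) simp
  then have g': "bij_betw g' B B'" using B(1) B'(1) by (simp add: insert_absorb)
  obtain L where L: "Vector_Spaces.linear (*s) (*s) L" "\<And>x. x \<in> B \<Longrightarrow> L x = g' x"
    using vec.linear_independent_extend[OF ind(1), of g'] by blast
  interpret L: Vector_Spaces.linear "(*s)" "(*s)" L by fact
  have on_basis: "h' (L x) (L y) = h x y" if "x \<in> B" "y \<in> B" for x y
    using B(2) B'(2) g' that unfolding h.orthonormal_def h'.orthonormal_def
    by (simp add: L(2) bij_betw_apply inj_on_eq_iff[OF bij_betw_imp_inj_on])
  \<comment> \<open>The identity spreads from the bases first in the linear argument, then in the
    semilinear one.\<close>
  have left: "h' (L x) (L y) = h x y" if "y \<in> B" for x y
  proof -
    have "x \<in> vec.span B" by (simp add: B(3))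
    then show ?thesis
      by (induction rule: vec.span_induct_alt)
        (simp_all add: L.add L.scale h.add_left h.scale_left h'.add_left h'.scale_left on_basis that)
  qed
  have isometry: "h' (L x) (L y) = h x y" for x y
  proof -
    have "y \<in> vec.span B" by (simp add: B(3))
    then show ?thesis
      by (induction rule: vec.span_induct_alt)
        (simp_all add: L.add L.scale h.add_right h.scale_right h'.add_right h'.scale_right left)
  qed
  have "inj L"
  proof (subst L.inj_iff_eq_0, safe)
    fix y assume "L y = 0"
    then have "h x y = 0" for x using isometry[of x y] by simp
    then show "y = 0" by (rule h.nondegenerate)
  qed
  moreover have "L e = e'" using L(2) B(1) by (simp add: g'_def)
  ultimately show thesis using that L(1) isometry by blast
qed

section \<open>Forms as functions\<close>

lemma exponent_of_degree_one:
  fixes m :: "'n::finite \<Rightarrow>\<^sub>0 nat"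
  assumes "(\<Sum>i\<in>UNIV. Poly_Mapping.lookup m i) = 1"
  shows "\<exists>i. m = Poly_Mapping.single i 1"
proof -
  from assms obtain i where "Poly_Mapping.lookup m i = 1"
    and "\<And>j. i \<noteq> j \<Longrightarrow> Poly_Mapping.lookup m j = 0"
    by (auto simp: sum_eq_Suc0_iff)
  then have "m = Poly_Mapping.single i 1"
    by (intro poly_mapping_eqI) (auto simp: lookup_single when_def)
  then show ?thesis ..
qed

definition monomial_value :: "'k::comm_ring_1 ^ 'n::finite \<Rightarrow> ('n \<Rightarrow>\<^sub>0 nat) \<Rightarrow> 'k" where
  "monomial_value v m = (\<Prod>i\<in>UNIV. (v $ i) ^ Poly_Mapping.lookup m i)"

lemma monomial_value_zero [simp]: "monomial_value v 0 = 1"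
  by (simp add: monomial_value_def)

lemma monomial_value_add: "monomial_value v (m + m') = monomial_value v m * monomial_value v m'"
  by (simp add: monomial_value_def lookup_add power_add prod.distrib)

lemma monomial_value_single [simp]:
  "monomial_value v (Poly_Mapping.single i n) = (v $ i) ^ n"
proof -
  have "monomial_value v (Poly_Mapping.single i n) = (\<Prod>j\<in>UNIV. if j = i then (v $ j) ^ n else 1)"
    unfolding monomial_value_def by (intro prod.cong) (auto simp: lookup_single when_def)
  then show ?thesis by simp
qed

text \<open>Enlarging the index set lets different polynomials be summed over common
  monomials.\<close>

lemma eval_superset:
  assumes "finite K" and "Poly_Mapping.keys f \<subseteq> K"
  shows "eval f v = (\<Sum>m\<in>K. Poly_Mapping.lookup f m * monomial_value v m)"
  unfolding eval_def monomial_value_def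
  by (intro sum.mono_neutral_left assms) (simp add: in_keys_iff)

lemma eval_zero [simp]: "eval 0 v = 0"
  by (simp add: eval_def)

lemma eval_single [simp]: "eval (Poly_Mapping.single m c) v = c * monomial_value v m"
  by (subst eval_superset[of "{m}"]) auto

lemma eval_one [simp]: "eval 1 v = 1"
  by (simp flip: single_one)

lemma eval_add: "eval (f + g) v = eval f v + eval g v"
proof -
  let ?K = "Poly_Mapping.keys f \<union> Poly_Mapping.keys g"
  have "eval (f + g) v = (\<Sum>m\<in>?K. Poly_Mapping.lookup (f + g) m * monomial_value v m)"
    using keys_add[of f g] by (intro eval_superset) auto
  also have "\<dots> = eval f v + eval g v"
    by (simp add: lookup_add distrib_right sum.distrib eval_superset[of ?K])
  finally show ?thesis .
qed

lemma eval_sum: "eval (\<Sum>i\<in>I. f i) v = (\<Sum>i\<in>I. eval (f i) v)"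
  by (induction I rule: infinite_finite_induct) (simp_all add: eval_add)

lemma gradient_superset:
  assumes "finite K" and "Poly_Mapping.keys f \<subseteq> K"
  shows "gradient f v $ k = (\<Sum>m\<in>K. of_nat (Poly_Mapping.lookup m k) * Poly_Mapping.lookup f m *
    monomial_value v (m - Poly_Mapping.single k 1))"
proof -
  have "gradient f v $ k = (\<Sum>m\<in>Poly_Mapping.keys f. of_nat (Poly_Mapping.lookup m k) *
      Poly_Mapping.lookup f m * monomial_value v (m - Poly_Mapping.single k 1))"
    by (simp add: gradient_def partial_deriv_def eval_sum)
  also have "\<dots> = (\<Sum>m\<in>K. of_nat (Poly_Mapping.lookup m k) * Poly_Mapping.lookup f m *
      monomial_value v (m - Poly_Mapping.single k 1))"
    by (intro sum.mono_neutral_left assms) (simp add: in_keys_iff)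
  finally show ?thesis .
qed

section \<open>Linear forms\<close>

lemma keys_linear_form:
  assumes "homogeneous 1 l"
  shows "Poly_Mapping.keys l \<subseteq> range (\<lambda>i. Poly_Mapping.single i 1)"
  using assms exponent_of_degree_one unfolding homogeneous_def by blast

lemma inj_single: "inj (\<lambda>i. Poly_Mapping.single i (1::nat))"
  by (auto simp: inj_on_def dest!: arg_cong[of _ _ "\<lambda>m. Poly_Mapping.lookup m _"]
      simp: lookup_single when_def split: if_splits)

lemma eval_linear_form:
  assumes "homogeneous 1 l"
  shows "eval l v = (\<Sum>i\<in>UNIV. Poly_Mapping.lookup l (Poly_Mapping.single i 1) * v $ i)"
  using eval_superset[OF _ keys_linear_form[OF assms], of v]
  by (simp add: sum.reindex[OF inj_single, unfolded One_nat_def] o_def)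

lemma gradient_linear_form:
  assumes "homogeneous 1 l"
  shows "gradient l v $ k = Poly_Mapping.lookup l (Poly_Mapping.single k 1)"
proof -
  have "gradient l v $ k = (\<Sum>i\<in>UNIV. of_nat (Poly_Mapping.lookup (Poly_Mapping.single i 1) k) *
      Poly_Mapping.lookup l (Poly_Mapping.single i 1) *
      monomial_value v (Poly_Mapping.single i 1 - Poly_Mapping.single k 1))"
    using gradient_superset[OF _ keys_linear_form[OF assms], of v k]
    by (simp add: sum.reindex[OF inj_single, unfolded One_nat_def] o_def)
  also have "\<dots> = (\<Sum>i\<in>UNIV. if i = k then Poly_Mapping.lookup l (Poly_Mapping.single i 1) else 0)"
    by (intro sum.cong) (auto simp: lookup_single)
  finally show ?thesis by simp
qed

lemma linear_form_functional:
  assumes "homogeneous 1 l"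
  shows "eval l (x + y) = eval l x + eval l y" and "eval l (c *s x) = c * eval l x"
    and "gradient l v $ k = eval l (axis k 1)"
proof -
  show "eval l (x + y) = eval l x + eval l y" "eval l (c *s x) = c * eval l x"
    by (simp_all add: eval_linear_form[OF assms] distrib_left sum.distrib sum_distrib_left
        mult.left_commute)
  have "eval l (axis k 1) =
      (\<Sum>i\<in>UNIV. if i = k then Poly_Mapping.lookup l (Poly_Mapping.single i 1) else 0)"
    unfolding eval_linear_form[OF assms] by (intro sum.cong) (auto simp: axis_def)
  then show "gradient l v $ k = eval l (axis k 1)"
    by (simp add: gradient_linear_form[OF assms])
qed

lemma hyperplane_form_attains_one:
  assumes "hyperplane_form l"
  obtains e where "eval l e = 1"
proof -
  from assms have l: "homogeneous 1 l" "l \<noteq> 0" by (simp_all add: hyperplane_form_def)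
  then obtain m where "m \<in> Poly_Mapping.keys l" by fastforce
  moreover from this obtain k where "m = Poly_Mapping.single k 1"
    using keys_linear_form[OF l(1)] by blast
  \<comment> \<open>The gradient of a linear form is constant, so it may be taken at the arbitrary
    point \<open>undefined\<close>.\<close>
  ultimately have nz: "eval l (axis k 1) \<noteq> 0"
    using gradient_linear_form[OF l(1), of undefined k]
    by (simp add: linear_form_functional(3)[OF l(1)] in_keys_iff)
  show thesis
    by (rule that[of "inverse (eval l (axis k 1)) *s axis k 1"])
      (simp add: linear_form_functional(2)[OF l(1)] nz)
qed

section \<open>Frobenius forms as sesquilinear forms\<close>

lemma var_power: "var i ^ n = Poly_Mapping.single (Poly_Mapping.single i n) 1"
  by (induction n) (simp_all add: var_def mult_single add.commute flip: single_add)

lemma keys_frobenius_ideal: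
  fixes f :: "('k::comm_ring_1, 'n::finite) poly_ring"
  assumes "f \<in> ideal_generated_by (range (\<lambda>i. var i ^ q))" and "m \<in> Poly_Mapping.keys f"
  shows "\<exists>j. q \<le> Poly_Mapping.lookup m j"
proof -
  interpret poly_ring: module "(*) :: ('k, 'n) poly_ring \<Rightarrow> _"
    by unfold_locales (simp_all add: algebra_simps)
  have "\<forall>m\<in>Poly_Mapping.keys f. \<exists>j. q \<le> Poly_Mapping.lookup m j"
    using assms(1) unfolding ideal_generated_by_def
  proof (induction rule: poly_ring.span_induct_alt)
    case base
    then show ?case by simp
  next
    case (step c x y)
    then obtain i where x: "x = Poly_Mapping.single (Poly_Mapping.single i q) 1"
      by (auto simp: var_power)
    have "q \<le> Poly_Mapping.lookup m i" if "m \<in> Poly_Mapping.keys (c * x)" for m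
      using that keys_mult[of c x] unfolding x by (auto simp: lookup_add)
    then show ?case using step keys_add[of "c * x" y] by blast
  qed
  then show ?thesis using assms(2) by blast
qed

text \<open>Removing the factor given by the \<open>q\<close>-th power of the variable
  \<open>j\<close> leaves a monomial of degree one.\<close>

lemma frobenius_exponent:
  fixes m :: "'n::finite \<Rightarrow>\<^sub>0 nat"
  assumes "(\<Sum>i\<in>UNIV. Poly_Mapping.lookup m i) = q + 1" and "q \<le> Poly_Mapping.lookup m j"
  shows "\<exists>i. m = Poly_Mapping.single i 1 + Poly_Mapping.single j q"
proof -
  define r where "r = m - Poly_Mapping.single j q"
  have m: "m = r + Poly_Mapping.single j q"
    using assms(2)
    by (intro poly_mapping_eqI) (auto simp: r_def lookup_add lookup_minus lookup_single when_def)
  have "(\<Sum>i\<in>UNIV. Poly_Mapping.lookup (Poly_Mapping.single j q) i) = q"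
    by (simp add: lookup_single when_def)
  then have "(\<Sum>i\<in>UNIV. Poly_Mapping.lookup r i) = 1"
    using assms(1) unfolding m by (simp add: lookup_add sum.distrib)
  then show ?thesis using exponent_of_degree_one m by blast
qed

text \<open>On a multiple of \<open>x\<^sub>j\<^sup>q\<close> only the complementary linear factor is differentiated.\<close>

lemma derivative_frobenius_monomial:
  fixes v :: "'k::comm_ring_1 ^ 'n::finite" and i j k :: 'n
  assumes "of_nat q = (0::'k)"
  defines "m \<equiv> Poly_Mapping.single i 1 + Poly_Mapping.single j q"
  shows "of_nat (Poly_Mapping.lookup m k) * monomial_value v (m - Poly_Mapping.single k 1)
    = axis k 1 $ i * (v $ j) ^ q"
proof (cases "k = i")
  case True
  have "of_nat (Poly_Mapping.lookup m k) = (1::'k)"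
    by (simp add: m_def True lookup_add lookup_single when_def assms(1))
  moreover have "m - Poly_Mapping.single k 1 = Poly_Mapping.single j q"
    by (simp add: m_def True)
  ultimately show ?thesis by (simp add: True)
next
  case False
  then have "of_nat (Poly_Mapping.lookup m k) = (0::'k)"
    by (simp add: m_def lookup_add lookup_single when_def assms(1))
  then show ?thesis using False by (simp add: axis_def)
qed

theorem frobenius_form_sesquilinear:
  fixes f :: "('k::alg_closed_field, 'n::finite) poly_ring"
  assumes "CHAR('k) > 0" and "frobenius_form f"
  obtains q h where "frobenius_sesquilinear q h" and "homogeneous (q + 1) f"
    and "\<And>v. eval f v = h v v" and "\<And>v k. gradient f v $ k = h (axis k 1) v"
proof -
  have prime: "prime CHAR('k)" using prime_CHAR_semidom assms(1) by blast
  obtain e where "e > 0" and hom: "homogeneous (CHAR('k) ^ e + 1) f"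
    and ideal: "f \<in> ideal_generated_by (range (\<lambda>i. var i ^ (CHAR('k) ^ e)))"
    using assms(2) unfolding frobenius_form_def by blast
  define q where "q = CHAR('k) ^ e"
  have q: "1 < q"
    unfolding q_def using prime_gt_1_nat[OF prime] \<open>e > 0\<close> by (rule one_less_power)
  have q0: "of_nat q = (0::'k)" using \<open>e > 0\<close> by (simp add: q_def)
  have "\<exists>i j. m = Poly_Mapping.single i 1 + Poly_Mapping.single j q"
    if "m \<in> Poly_Mapping.keys f" for m
    using keys_frobenius_ideal[OF ideal that] frobenius_exponent hom that
    unfolding homogeneous_def q_def by metis
  then obtain i j where keys: "\<And>m. m \<in> Poly_Mapping.keys f \<Longrightarrow>
      m = Poly_Mapping.single (i m) 1 + Poly_Mapping.single (j m) q"
    by metis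
  \<comment> \<open>Each monomial is polarised: its linear factor goes to \<open>x\<close>, its
    \<open>q\<close>-th power to \<open>y\<close>.\<close>
  define h where
    "h x y = (\<Sum>m\<in>Poly_Mapping.keys f. Poly_Mapping.lookup f m * x $ i m * (y $ j m) ^ q)"
    for x y :: "'k ^ 'n"
  have frob: "(a + b) ^ q = a ^ q + b ^ q" for a b :: 'k
    using freshmans_dream'[OF prime q_def] .
  have "frobenius_sesquilinear q h"
    by (unfold_locales, rule q, rule frob)
      (simp_all add: frob h_def algebra_simps sum.distrib sum_distrib_left power_mult_distrib)
  moreover have "homogeneous (q + 1) f" using hom by (simp add: q_def)
  moreover have "eval f v = h v v" for v
  proof -
    have "monomial_value v m = v $ i m * (v $ j m) ^ q" if "m \<in> Poly_Mapping.keys f" for m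
      by (subst keys[OF that]) (simp add: monomial_value_add)
    then show ?thesis
      by (simp add: h_def eval_superset[of "Poly_Mapping.keys f"] mult.assoc)
  qed
  moreover have "gradient f v $ k = h (axis k 1) v" for v k
  proof -
    have "of_nat (Poly_Mapping.lookup m k) * monomial_value v (m - Poly_Mapping.single k 1)
        = axis k 1 $ i m * (v $ j m) ^ q" if "m \<in> Poly_Mapping.keys f" for m
      using derivative_frobenius_monomial[OF q0, of "i m" "j m" k v] keys[OF that] by simp
    then show ?thesis
      unfolding h_def gradient_superset[OF finite_keys order_refl]
      by (intro sum.cong) (simp_all add: ac_simps)
  qed
  ultimately show thesis by (rule that)
qed

section \<open>Linear maps as morphisms of projective varieties\<close>

lemma proj_class_image:
  assumes "Vector_Spaces.linear (*s) (*s) L"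
  shows "L ` proj_class v = proj_class (L v)"
proof -
  interpret L: Vector_Spaces.linear "(*s)" "(*s)" L by fact
  show ?thesis by (simp add: proj_class_def setcompr_eq_image image_image L.scale)
qed

lemma zariski_open_proj_space: "zariski_open (proj_space :: ('k::field, 'n::finite) proj_point set)"
  unfolding zariski_open_def
proof (intro exI[of _ "{1}"] conjI)
  have "homogeneous 0 (1 :: ('k, 'n) poly_ring)"
    unfolding homogeneous_def by (simp flip: single_one)
  then show "\<forall>f\<in>{1 :: ('k, 'n) poly_ring}. \<exists>d. homogeneous d f" by blast
  show "proj_space = proj_space - proj_zeros {1 :: ('k, 'n) poly_ring}"
    by (simp add: proj_zeros_def)
qed

lemma linear_map_forms:
  fixes L :: "'k::field ^ 'n::finite \<Rightarrow> 'k ^ 'm::finite"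
  assumes "Vector_Spaces.linear (*s) (*s) L"
  obtains F where "\<And>j. homogeneous 1 (F j)" and "\<And>v. (\<chi> j. eval (F j) v) = L v"
proof -
  define F :: "'m \<Rightarrow> ('k, 'n) poly_ring" where
    "F j = (\<Sum>i\<in>UNIV. Poly_Mapping.single (Poly_Mapping.single i 1) (L (axis i 1) $ j))" for j
  have "homogeneous 1 (F j)" for j
    unfolding homogeneous_def
  proof
    fix m assume "m \<in> Poly_Mapping.keys (F j)"
    then have "(\<Sum>i\<in>UNIV. L (axis i 1) $ j when Poly_Mapping.single i 1 = m) \<noteq> 0"
      by (simp add: F_def in_keys_iff lookup_sum lookup_single)
    then obtain i where "m = Poly_Mapping.single i 1"
      by (metis (mono_tags, lifting) sum.neutral when_simps(2))
    then show "(\<Sum>i\<in>UNIV. Poly_Mapping.lookup m i) = 1"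
      by (simp add: lookup_single when_def)
  qed
  moreover have "(\<chi> j. eval (F j) v) = L v" for v
    by (simp add: vec_eq_iff F_def eval_sum linear_componentwise[OF assms, of v] mult.commute)
  ultimately show thesis by (rule that)
qed

text \<open>Projective points are sets of vectors, so \<open>L\<close> acts on them by images. One
  chart, all of projective space, with forms of degree 1 is enough.\<close>

lemma linear_proj_morphism:
  fixes L :: "'k::field ^ 'n::finite \<Rightarrow> 'k ^ 'm::finite"
  assumes "Vector_Spaces.linear (*s) (*s) L" and nz: "\<And>v. v \<noteq> 0 \<Longrightarrow> L v \<noteq> 0"
    and zeros: "\<And>v. \<forall>f\<in>S. eval f v = 0 \<Longrightarrow> \<forall>f\<in>S'. eval f (L v) = 0"
  shows "proj_morphism (proj_zeros S) (proj_zeros S') ((`) L)"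
  unfolding proj_morphism_def
proof (intro conjI ballI)
  show "(`) L ` proj_zeros S \<subseteq> proj_zeros S'"
    unfolding proj_zeros_def
    by (clarsimp simp: proj_class_image[OF assms(1)]) (use nz zeros in blast)
next
  fix P assume "P \<in> proj_zeros S"
  then have P: "P \<in> proj_space" by (auto simp: proj_zeros_def proj_space_def)
  obtain F where F: "\<And>j. homogeneous 1 (F j)" "\<And>v. (\<chi> j. eval (F j) v) = L v"
    using linear_map_forms[OF assms(1)] by blast
  show "\<exists>U. zariski_open U \<and> P \<in> U \<and> (\<exists>d F. (\<forall>j. homogeneous d (F j)) \<and>
      (\<forall>v. v \<noteq> 0 \<and> proj_class v \<in> proj_zeros S \<inter> U \<longrightarrow> (\<chi> j. eval (F j) v) \<noteq> 0 \<and>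
        L ` proj_class v = proj_class (\<chi> j. eval (F j) v)))"
    using F nz
    by (intro exI[of _ proj_space] exI[of _ 1] exI[of _ F] conjI zariski_open_proj_space P)
      (auto simp: proj_class_image[OF assms(1)])
qed

section \<open>Smooth hyperplane sections\<close>

text \<open>A form that is nondegenerate on the hyperplane \<open>\<phi> = 0\<close> is extended to the whole space by making
  a complementary unit vector \<open>e\<close> orthogonal to the hyperplane from both sides.\<close>

lemma extend_from_hyperplane:
  fixes h :: "'k::alg_closed_field ^ 'n::finite \<Rightarrow> 'k ^ 'n \<Rightarrow> 'k"
  assumes "frobenius_sesquilinear q h"
    and \<phi>_add: "\<And>x y. \<phi> (x + y) = \<phi> x + \<phi> y" and \<phi>_scale: "\<And>c x. \<phi> (c *s x) = c * \<phi> x"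
    and \<phi>_e: "\<phi> e = 1"
    and nondeg: "\<And>v. \<phi> v = 0 \<Longrightarrow> (\<And>w. \<phi> w = 0 \<Longrightarrow> h w v = 0) \<Longrightarrow> v = 0"
  obtains H where "nondegenerate_sesquilinear q H" and "frobenius_sesquilinear.hermitian q H e"
    and "\<And>x. H x e = \<phi> x" and "\<And>x y. \<phi> x = 0 \<Longrightarrow> \<phi> y = 0 \<Longrightarrow> H x y = h x y"
proof -
  interpret h: frobenius_sesquilinear q h by fact
  define p where "p x = x - \<phi> x *s e" for x
  have p_add: "p (x + y) = p x + p y" for x y
    by (simp add: p_def \<phi>_add vec.scale_left_distrib)
  have p_scale: "p (c *s x) = c *s p x" for c x
    by (simp add: p_def \<phi>_scale vec.scale_right_diff_distrib)
  have p_e: "p e = 0" by (simp add: p_def \<phi>_e)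
  have p_id: "p x = x" if "\<phi> x = 0" for x using that by (simp add: p_def)
  \<comment> \<open>With \<open>p\<close> the projection onto the hyperplane along \<open>e\<close>,
    this is the orthogonal sum of \<open>h\<close> on the hyperplane and the unit form on the line
    of \<open>e\<close>.\<close>
  define H where "H x y = h (p x) (p y) + \<phi> x * \<phi> y ^ q" for x y
  have H: "frobenius_sesquilinear q H"
    by (unfold_locales, rule h.q, rule h.frobenius_add)
      (simp_all add: H_def p_add p_scale \<phi>_add \<phi>_scale h.add_left h.add_right h.scale_left
        h.scale_right h.frobenius_add power_mult_distrib algebra_simps)
  have He: "H x e = \<phi> x" and eH: "H e x = \<phi> x ^ q" for x
    by (simp_all add: H_def p_e \<phi>_e)
  have Hh: "H x y = h x y" if "\<phi> x = 0" "\<phi> y = 0" for x y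
    using that by (simp add: H_def p_id)
  have "nondegenerate_sesquilinear q H"
  proof (rule nondegenerate_sesquilinear.intro[OF H], unfold_locales)
    fix v assume v: "\<And>x. H x v = 0"
    \<comment> \<open>Pairing with \<open>e\<close> forces \<open>v\<close> into the hyperplane,
      where \<open>H\<close> agrees with \<open>h\<close>.\<close>
    have "\<phi> v = 0" using v[of e] eH by simp
    then show "v = 0" using v Hh by (intro nondeg) metis+
  qed
  moreover have "frobenius_sesquilinear.hermitian q H e"
    by (simp add: frobenius_sesquilinear.hermitian_def[OF H] He eH)
  ultimately show thesis using that He Hh by blast
qed

text \<open>Proportional gradients would give a Jacobian of rank at most 1, while
  \<open>f \<noteq> l\<close> makes the required rank 2.\<close>

lemma smooth_section_gradient:
  assumes "smooth_complete_intersection {f, l}" and "f \<noteq> l"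
    and "v \<noteq> 0" and "eval f v = 0" and "eval l v = 0"
  shows "gradient f v \<noteq> c *s gradient l v"
proof
  assume "gradient f v = c *s gradient l v"
  then have "(\<lambda>f. gradient f v) ` {f, l} \<subseteq> vec.span {gradient l v}"
    by (auto intro: vec.span_base vec.span_scale)
  then have "vec.dim ((\<lambda>f. gradient f v) ` {f, l}) \<le> card {gradient l v}"
    by (rule vec.dim_le_card) simp
  moreover have "vec.dim ((\<lambda>f. gradient f v) ` {f, l}) = card {f, l}"
    using assms unfolding smooth_complete_intersection_def by simp
  ultimately show False using assms(2) by simp
qed

text \<open>A nonzero \<open>v\<close> in the kernel of \<open>h\<close> on the hyperplane would be
  a singular point of the section: it satisfies \<open>h v v = 0\<close>, and its gradient
  functional vanishes on the hyperplane, hence is a multiple of \<open>l\<close>.\<close>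

lemma smooth_hyperplane_section_nondegenerate:
  fixes f l :: "('k::alg_closed_field, 'n::finite) poly_ring"
  assumes sesq: "frobenius_sesquilinear q h" and hom: "homogeneous (q + 1) f"
    and eval_f: "\<And>v. eval f v = h v v" and gradient_f: "\<And>v k. gradient f v $ k = h (axis k 1) v"
    and l: "hyperplane_form l" and smooth: "smooth_complete_intersection {f, l}"
  obtains H e where "nondegenerate_sesquilinear q H" and "frobenius_sesquilinear.hermitian q H e"
    and "H e e = 1" and "\<And>x. H x e = eval l x" and "\<And>v. eval l v = 0 \<Longrightarrow> H v v = eval f v"
proof -
  interpret h: frobenius_sesquilinear q h by fact
  have hom_l: "homogeneous 1 l" and "l \<noteq> 0" using l by (simp_all add: hyperplane_form_def)
  note functional = linear_form_functional[OF hom_l]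
  obtain m where "m \<in> Poly_Mapping.keys l" using \<open>l \<noteq> 0\<close> by fastforce
  \<comment> \<open>The degrees \<open>q + 1\<close> and 1 differ, and a monomial of
    \<open>l\<close> witnesses this.\<close>
  then have "f \<noteq> l" using hom hom_l h.q unfolding homogeneous_def by fastforce
  obtain e where e: "eval l e = 1" using hyperplane_form_attains_one[OF l] by blast
  have "v = 0" if v: "eval l v = 0" "\<And>w. eval l w = 0 \<Longrightarrow> h w v = 0" for v
  proof (rule ccontr)
    assume "v \<noteq> 0"
    have functional_v: "h x v = h e v * eval l x" for x
    proof -
      \<comment> \<open>Subtracting the right multiple of \<open>e\<close> moves \<open>x\<close>
        into the hyperplane.\<close>
      have "eval l (x + (- eval l x) *s e) = 0" by (simp only: functional e) simp
      then have "h (x + (- eval l x) *s e) v = 0" by (rule v(2))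
      then show ?thesis by (simp add: h.diff_left h.scale_left mult.commute)
    qed
    have "gradient f v $ k = h e v * gradient l v $ k" for k
      unfolding gradient_f functional(3) by (rule functional_v)
    then have "gradient f v = h e v *s gradient l v" by (simp add: vec_eq_iff)
    moreover have "eval f v = 0" using v by (simp add: eval_f)
    ultimately show False
      using smooth_section_gradient[OF smooth \<open>f \<noteq> l\<close> \<open>v \<noteq> 0\<close>] v(1) by blast
  qed
  then obtain H where "nondegenerate_sesquilinear q H" "frobenius_sesquilinear.hermitian q H e"
    "\<And>x. H x e = eval l x" "\<And>x y. eval l x = 0 \<Longrightarrow> eval l y = 0 \<Longrightarrow> H x y = h x y"
    using extend_from_hyperplane[OF sesq functional(1,2) e] by blast
  then show thesis using that e eval_f by simp
qed

theorem corollary8p3: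
  fixes f l l' :: "('k::alg_closed_field, 'n::finite) poly_ring"
  assumes "CHAR('k) > 0"
    and "frobenius_form f"
    and "smooth_complete_intersection {f}"
    and "hyperplane_form l" and "smooth_complete_intersection {f, l}"
    and "hyperplane_form l'" and "smooth_complete_intersection {f, l'}"
  shows "proj_isomorphic (proj_zeros {f, l}) (proj_zeros {f, l'})"
proof -
  obtain q h where form: "frobenius_sesquilinear q h" "homogeneous (q + 1) f"
    "\<And>v. eval f v = h v v" "\<And>v k. gradient f v $ k = h (axis k 1) v"
    using frobenius_form_sesquilinear[OF assms(1,2)] by blast
  obtain H e where H: "nondegenerate_sesquilinear q H" "frobenius_sesquilinear.hermitian q H e"
    "H e e = 1" "\<And>x. H x e = eval l x" "\<And>v. eval l v = 0 \<Longrightarrow> H v v = eval f v"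
    using smooth_hyperplane_section_nondegenerate[OF form assms(4,5)] by blast
  obtain H' e' where H': "nondegenerate_sesquilinear q H'"
    "frobenius_sesquilinear.hermitian q H' e'" "H' e' e' = 1"
    "\<And>x. H' x e' = eval l' x" "\<And>v. eval l' v = 0 \<Longrightarrow> H' v v = eval f v"
    using smooth_hyperplane_section_nondegenerate[OF form assms(6,7)] by blast
  obtain L where L: "Vector_Spaces.linear (*s) (*s) L" "inj L" "L e = e'"
    "\<And>x y. H' (L x) (L y) = H x y"
    using nondegenerate_isometry[OF H(1) H'(1) H(2,3) H'(2,3)] by blast
  obtain M where M: "Vector_Spaces.linear (*s) (*s) M" "\<And>x. M (L x) = x" "\<And>x. L (M x) = x"
    using vec.linear_injective_isomorphism[OF L(1,2)] by auto
  interpret L: Vector_Spaces.linear "(*s)" "(*s)" L by fact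
  interpret M: Vector_Spaces.linear "(*s)" "(*s)" M by fact
  \<comment> \<open>Both linear forms are pairings with the distinguished vectors, so
    \<open>L e = e'\<close> makes \<open>L\<close> carry one hyperplane to the other.\<close>
  have l: "eval l' (L x) = eval l x" for x
    using L(4)[of x e] by (simp add: L(3) H(4) H'(4))
  have f: "eval f (L x) = eval f x" if "eval l x = 0" for x
    using L(4)[of x x] that by (simp add: l H(5) H'(5))
  have "proj_morphism (proj_zeros {f, l}) (proj_zeros {f, l'}) ((`) L)"
    using L(1)
  proof (rule linear_proj_morphism)
    show "L v \<noteq> 0" if "v \<noteq> 0" for v using that M(2)[of v] by auto
  qed (simp add: l f)
  moreover have "proj_morphism (proj_zeros {f, l'}) (proj_zeros {f, l}) ((`) M)"
    using M(1)
  proof (rule linear_proj_morphism)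
    show "M v \<noteq> 0" if "v \<noteq> 0" for v using that M(3)[of v] by auto
    \<comment> \<open>The identities for \<open>L\<close> are applied at \<open>M v\<close>: first
      \<open>l\<close> to reach the hyperplane, then \<open>f\<close>, which is preserved only
      there.\<close>
    show "\<forall>g\<in>{f, l}. eval g (M v) = 0" if "\<forall>g\<in>{f, l'}. eval g v = 0" for v
      using that l[of "M v"] f[of "M v"] by (simp add: M(3))
  qed
  moreover have "M ` L ` P = P" "L ` M ` P = P" for P by (simp_all add: image_image M)
  ultimately show ?thesis unfolding proj_isomorphic_def by blast
qed

end
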